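(* There exists a whole family of Cantor sets $K\subset\mathbb R$ such that: (1) $K$ is linearly independent over $\mathbb Q$; (2) $\dim_H^{\log}(K)=0$; (3) there do not exist infinite sets $S_1,S_2,S_3\subset\mathbb R$ with $$S_1+S_2+S_3\subset K.$$
   Context: A Cantor set is a nonempty compact, perfect, totally disconnected subset of $\mathbb R$ (equivalently, a subset of $\mathbb R$ homeomorphic to $\{0,1\}^{\mathbb N}$). $K\subset\mathbb R$ is linearly independent over $\mathbb Q$ if for any distinct $y_1,\dots,y_m\in K$ and nonzero rationals $q_1,\dots,q_m$ ($m\ge1$) one has $q_1y_1+\cdots+q_my_m\ne0$. $S_1+S_2+S_3=\{s_1+s_2+s_3:s_i\in S_i\}$. For $s>0$ let $h_s(r)=(\log(1/r))^{-s}$ for $0<r<e^{-1}$ (with $h_s(0)=0$), and let $\mathcal H^{h_s}(F)=\lim_{\delta\to0}\inf\{\sum_ih_s(\operatorname{diam}(U_i)):\operatorname{diam}(U_i)<\delta,\ F\subset\bigcup_iU_i\}$, the infimum being over countable covers; the logarithmic Hausdorff dimension is $\dim_H^{\log}(F)=\inf\{s>0:\mathcal H^{h_s}(F)=0\}$. *)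

theory Defs
  imports "HOL-Analysis.Analysis" "HOL-Library.Set_Algebras"
begin

definition cantor_set :: "real set \<Rightarrow> bool" where
  "cantor_set K \<longleftrightarrow> K \<noteq> {} \<and> compact K \<and> (\<forall>x\<in>K. x islimpt K) \<and>
     (\<forall>C\<subseteq>K. connected C \<longrightarrow> (\<forall>x\<in>C. \<forall>y\<in>C. x = y))"

definition rat_independent :: "real set \<Rightarrow> bool" where
  "rat_independent K \<longleftrightarrow> module.independent (\<lambda>(q::rat) (x::real). of_rat q * x) K"

lemma rat_independent_iff:
  "rat_independent K \<longleftrightarrow>
     (\<forall>Y q. finite Y \<and> Y \<noteq> {} \<and> Y \<subseteq> K \<and> (\<forall>y\<in>Y. q y \<noteq> (0::rat)) \<longrightarrow> (\<Sum>y\<in>Y. of_rat (q y) * y) \<noteq> 0)"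
proof -
  interpret module "\<lambda>(q::rat) (x::real). of_rat q * x"
    by unfold_locales (auto simp: algebra_simps of_rat_add of_rat_mult)
  show ?thesis
  proof
    assume "rat_independent K"
    then show "\<forall>Y q. finite Y \<and> Y \<noteq> {} \<and> Y \<subseteq> K \<and> (\<forall>y\<in>Y. q y \<noteq> (0::rat)) \<longrightarrow>
        (\<Sum>y\<in>Y. of_rat (q y) * y) \<noteq> 0"
      unfolding rat_independent_def dependent_explicit by blast
  next
    assume *: "\<forall>Y q. finite Y \<and> Y \<noteq> {} \<and> Y \<subseteq> K \<and> (\<forall>y\<in>Y. q y \<noteq> (0::rat)) \<longrightarrow>
        (\<Sum>y\<in>Y. of_rat (q y) * y) \<noteq> 0"
    show "rat_independent K"
      unfolding rat_independent_def dependent_explicit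
    proof clarify
      fix t :: "real set" and u :: "real \<Rightarrow> rat" and v
      assume t: "finite t" "t \<subseteq> K" "(\<Sum>v\<in>t. of_rat (u v) * v) = 0" "v \<in> t" "u v \<noteq> 0"
      define Y where "Y = {y\<in>t. u y \<noteq> 0}"
      have "(\<Sum>y\<in>Y. of_rat (u y) * y) = (\<Sum>y\<in>t. of_rat (u y) * y)"
        using t(1) by (intro sum.mono_neutral_left) (auto simp: Y_def)
      moreover have "(\<Sum>y\<in>Y. of_rat (u y) * y) \<noteq> 0"
        using t by (intro *[rule_format]) (auto simp: Y_def)
      ultimately show False using t(3) by simp
    qed
  qed
qed

text \<open>
  The gauge is only meaningful for \<open>r < exp (-1)\<close>; its value for larger \<open>r\<close> is a dummy
  and does not affect the limit \<open>\<delta> \<rightarrow> 0\<close> below.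
\<close>

definition log_gauge :: "real \<Rightarrow> real \<Rightarrow> real" where
  "log_gauge s r = (if 0 < r \<and> r < exp (-1) then ln (1 / r) powr (-s) else 0)"

text \<open>
  Boundedness of the covering sets is explicit because \<^const>\<open>diameter\<close> is unspecified for
  unbounded sets. Finite covers are included by padding with empty sets, which contribute \<open>0\<close>.
\<close>

definition log_premeasure :: "real \<Rightarrow> real set \<Rightarrow> real \<Rightarrow> ennreal" where
  "log_premeasure s F \<delta> =
     (INF U \<in> {U :: nat \<Rightarrow> real set. (\<forall>i. bounded (U i) \<and> diameter (U i) < \<delta>) \<and> F \<subseteq> (\<Union>i. U i)}.
        \<Sum>i. ennreal (log_gauge s (diameter (U i))))"

definition log_hausdorff_measure :: "real \<Rightarrow> real set \<Rightarrow> ennreal" where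
  "log_hausdorff_measure s F = Lim (at_right 0) (log_premeasure s F)"

lemma log_premeasure_antimono: "antimono (log_premeasure s F)"
  unfolding log_premeasure_def
  by (intro antimonoI INF_superset_mono) (force intro: less_le_trans)+

text \<open>The limit defining the measure always exists.\<close>

lemma log_premeasure_tendsto:
  "(log_premeasure s F \<longlongrightarrow> (SUP \<delta>\<in>{0<..}. log_premeasure s F \<delta>)) (at_right 0)"
proof (rule order_tendstoI)
  fix a assume "a < (SUP \<delta>\<in>{0<..}. log_premeasure s F \<delta>)"
  then obtain d where d: "0 < d" "a < log_premeasure s F d"
    by (auto simp: less_SUP_iff)
  show "eventually (\<lambda>\<delta>. a < log_premeasure s F \<delta>) (at_right 0)"
    using eventually_at_right_real[OF d(1)]
  proof eventually_elim
    case (elim e)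
    then have "log_premeasure s F d \<le> log_premeasure s F e"
      by (intro antimonoD[OF log_premeasure_antimono]) auto
    with d(2) show ?case by order
  qed
next
  fix a assume a: "(SUP \<delta>\<in>{0<..}. log_premeasure s F \<delta>) < a"
  show "eventually (\<lambda>\<delta>. log_premeasure s F \<delta> < a) (at_right 0)"
    using eventually_at_right_less[of "0::real"]
  proof eventually_elim
    case (elim e)
    then have "log_premeasure s F e \<le> (SUP \<delta>\<in>{0<..}. log_premeasure s F \<delta>)"
      by (intro SUP_upper) auto
    with a show ?case by order
  qed
qed

lemma log_hausdorff_measure_eq_SUP:
  "log_hausdorff_measure s F = (SUP \<delta>\<in>{0<..}. log_premeasure s F \<delta>)"
  unfolding log_hausdorff_measure_def
  by (rule tendsto_Lim[OF _ log_premeasure_tendsto]) simp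

text \<open>Extended-real valued, so that the infimum over the empty set is \<open>\<infinity>\<close>.\<close>

definition log_hausdorff_dim :: "real set \<Rightarrow> ereal" where
  "log_hausdorff_dim F = Inf (ereal ` {s. 0 < s \<and> log_hausdorff_measure s F = 0})"

end

theory Submission
  imports Defs
begin

text \<open>
  Attach to every infinite branch of the binary tree the sum of \<open>2\<close> to the power \<open>-2\<^sup>m\<close> over the labels
  \<open>m\<close> of its nodes. A rational relation between such sums becomes, after clearing denominators, a
  vanishing series with bounded integer coefficients along a lacunary sequence, so almost all of its
  coefficients vanish; since distinct branches share only finitely many nodes, the relation is trivial.
  The \<open>2\<^sup>n\<close> cylinders of level \<open>n\<close> have a diameter whose logarithm is exponentially large in \<open>2\<^sup>n\<close>, so
  every logarithmic measure vanishes. Fixing the digits of the branch at even levels gives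
  uncountably many disjoint Cantor subsets. Finally \<open>(x + y) - (x' + y) - (x + y') + (x' + y') = 0\<close>
  excludes triple sumsets, and independence excludes intervals.
\<close>

section \<open>Lacunary series with bounded integer coefficients\<close>

text \<open>The exponents \<open>2 ^ m\<close> double at each step, so each term is the square of
  the one before. The common denominator \<open>2 ^ 2 ^ N\<close> of the terms up to
  \<open>N\<close> therefore still leaves the next term small.\<close>

definition lac :: "nat \<Rightarrow> real" where
  "lac m = (1/2) ^ (2 ^ m)"

lemma lac_pos: "0 < lac m"
  by (simp add: lac_def)

text \<open>Comparison with a geometric series, which settles summability and tail bounds alike. It
  comes down to \<open>2 ^ N + k \<le> (k + 1) * 2 ^ N \<le> 2 ^ (k + N)\<close> in the
  exponents.\<close>

lemma lac_add_le: "lac (k + N) \<le> lac N * (1/2) ^ k"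
proof -
  have "k + 1 \<le> (2::nat) ^ k"
    by (metis Suc_eq_plus1 Suc_leI less_exp)
  then have "(k + 1) * 2 ^ N \<le> (2::nat) ^ k * 2 ^ N"
    by (rule mult_right_mono) simp
  moreover have "2 ^ N + k \<le> (k + 1) * (2::nat) ^ N"
    by simp
  ultimately have "2 ^ N + k \<le> (2::nat) ^ (k + N)"
    unfolding power_add by linarith
  then have "(1/2::real) ^ (2 ^ (k + N)) \<le> (1/2) ^ (2 ^ N + k)"
    by (intro power_decreasing) auto
  then show ?thesis
    by (simp add: lac_def power_add)
qed

lemma summable_lac:
  assumes "\<And>m. \<bar>c m\<bar> \<le> B"
  shows "summable (\<lambda>m. c m * lac m)"
proof (rule summable_comparison_test')
  show "summable (\<lambda>m. B * lac 0 * (1/2) ^ m)"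
    by (intro summable_mult summable_geometric) simp
  show "norm (c m * lac m) \<le> B * lac 0 * (1/2) ^ m" if "0 \<le> m" for m
    using mult_mono[OF assms[of m] lac_add_le[of m 0]] lac_pos[of m] assms[of m]
    by (simp add: abs_mult mult.assoc)
qed

lemma lac_tendsto_0: "lac \<longlonglongrightarrow> 0"
proof (rule tendsto_sandwich[of "\<lambda>_. 0"])
  show "(\<lambda>m. lac 0 * (1/2) ^ m) \<longlonglongrightarrow> 0"
    by (intro tendsto_mult_right_zero LIMSEQ_power_zero) simp
  show "\<forall>\<^sub>F m in sequentially. lac m \<le> lac 0 * (1/2) ^ m"
    using lac_add_le[of _ 0] by simp
qed (simp_all add: less_imp_le[OF lac_pos])

text \<open>After a shift by \<open>N\<close> the terms are dominated by a geometric series of ratio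
  \<open>1/2\<close>, whose sum is the factor \<open>2\<close>.\<close>

lemma lac_tail_le:
  assumes bd: "\<And>m. \<bar>c m\<bar> \<le> B" and zero: "\<And>m. m < N \<Longrightarrow> c m = 0"
  shows "\<bar>\<Sum>m. c m * lac m\<bar> \<le> 2 * B * lac N"
proof -
  have "(\<Sum>m. c m * lac m) = (\<Sum>k. c (k + N) * lac (k + N))"
    using suminf_split_initial_segment[OF summable_lac[of c B, OF bd], of N] zero by simp
  moreover have "norm (\<Sum>k. c (k + N) * lac (k + N)) \<le> (\<Sum>k. B * lac N * (1/2) ^ k)"
  proof (rule norm_suminf_le)
    show "norm (c (k + N) * lac (k + N)) \<le> B * lac N * (1/2) ^ k" for k
      using mult_mono[OF bd[of "k + N"] lac_add_le[of k N]] lac_pos[of "k + N"] bd[of "k + N"]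
      by (simp add: abs_mult mult.assoc)
  qed (intro summable_mult summable_geometric, simp)
  moreover have "(\<Sum>k. B * lac N * (1/2) ^ k) = 2 * B * lac N"
    by (simp add: suminf_mult suminf_geometric)
  ultimately show ?thesis
    by simp
qed

lemma lac_partial_sum_int:
  fixes c :: "nat \<Rightarrow> int"
  shows "2 ^ 2 ^ N * (\<Sum>m\<le>N. of_int (c m) * lac m) \<in> \<int>"
proof -
  have "2 ^ 2 ^ N * (of_int (c m) * lac m) \<in> \<int>" if "m \<le> N" for m
  proof -
    have "(2::nat) ^ m \<le> 2 ^ N"
      using that by (intro power_increasing) auto
    then have "2 ^ 2 ^ N * lac m = (2::real) ^ (2 ^ N - 2 ^ m)"
      by (simp add: lac_def power_diff power_one_over)
    then have "2 ^ 2 ^ N * (of_int (c m) * lac m) = of_int (c m) * (2::real) ^ (2 ^ N - 2 ^ m)"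
      by (simp only: mult.left_commute)
    also have "\<dots> = of_int (c m * 2 ^ (2 ^ N - 2 ^ m))"
      by simp
    also have "\<dots> \<in> \<int>"
      by (rule Ints_of_int)
    finally show ?thesis .
  qed
  then show ?thesis
    unfolding sum_distrib_left by (intro Ints_sum) auto
qed

text \<open>
  Scaled by the common denominator, every late partial sum is an integer which is as small as the
  tail, hence is zero; consecutive partial sums differ by a single term.
\<close>

lemma lac_series_eq_0_imp_eventually_0:
  fixes c :: "nat \<Rightarrow> int"
  assumes bd: "\<And>m. \<bar>c m\<bar> \<le> B" and sum0: "(\<Sum>m. of_int (c m) * lac m) = 0"
  shows "\<forall>\<^sub>F m in sequentially. c m = 0"
proof -
  let ?S = "\<lambda>N. \<Sum>m\<le>N. of_int (c m) * lac m"
  have bd': "\<bar>of_int (c m)\<bar> \<le> (of_int B :: real)" for m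
    using bd[of m] by linarith
  have "B \<ge> 0"
    using bd[of 0] by linarith
  have S_le: "\<bar>2 ^ 2 ^ N * ?S N\<bar> \<le> 2 * of_int B * lac N" for N
  proof -
    \<comment> \<open>Cutting off the terms up to \<open>N\<close> puts the remainder in the form of
      a tail starting at \<open>Suc N\<close>. Since the whole series is zero, this tail is minus
      the partial sum.\<close>
    define c' where "c' m = (if m < Suc N then 0 else of_int (c m) :: real)" for m
    have "(\<Sum>m. c' m * lac m) = (\<Sum>k. c' (k + Suc N) * lac (k + Suc N)) + (\<Sum>m<Suc N. c' m * lac m)"
      by (intro suminf_split_initial_segment summable_lac[of _ "of_int B"])
        (use bd' \<open>B \<ge> 0\<close> in \<open>auto simp: c'_def\<close>)
    then have "(\<Sum>m. c' m * lac m) = (\<Sum>k. of_int (c (k + Suc N)) * lac (k + Suc N))"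
      by (simp add: c'_def)
    moreover have "0 = (\<Sum>k. of_int (c (k + Suc N)) * lac (k + Suc N)) + ?S N"
      using suminf_split_initial_segment[OF summable_lac[of "\<lambda>m. of_int (c m)" "of_int B", OF bd'], of "Suc N"]
      unfolding sum0 lessThan_Suc_atMost .
    ultimately have "\<bar>?S N\<bar> = \<bar>\<Sum>m. c' m * lac m\<bar>"
      by linarith
    also have "\<dots> \<le> 2 * of_int B * lac (Suc N)"
      by (rule lac_tail_le) (use bd' \<open>B \<ge> 0\<close> in \<open>auto simp: c'_def\<close>)
    finally have "2 ^ 2 ^ N * \<bar>?S N\<bar> \<le> 2 ^ 2 ^ N * (2 * of_int B * lac (Suc N))"
      by (intro mult_left_mono) auto
    \<comment> \<open>\<open>lac (Suc N)\<close> is the square of \<open>lac N\<close>, and the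
      denominator cancels only one of the two factors.\<close>
    also have "(2::real) ^ 2 ^ N * lac (Suc N) = lac N"
      by (simp add: lac_def power_one_over mult_2 power_add)
    then have "2 ^ 2 ^ N * (2 * of_int B * lac (Suc N)) = 2 * of_int B * lac N"
      by (simp add: mult.left_commute)
    finally show ?thesis
      by (simp add: abs_mult)
  qed
  have "(\<lambda>N. 2 * of_int B * lac N) \<longlonglongrightarrow> 0"
    by (intro tendsto_mult_right_zero lac_tendsto_0)
  then have "\<forall>\<^sub>F N in sequentially. 2 * of_int B * lac N < 1"
    by (rule order_tendstoD) simp
  then have S0: "\<forall>\<^sub>F N in sequentially. ?S N = 0"
  proof eventually_elim
    case (elim N)
    obtain z where z: "2 ^ 2 ^ N * ?S N = of_int z"
      using lac_partial_sum_int[of N c] by (elim Ints_cases)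
    have "\<bar>of_int z\<bar> < (1::real)"
      using S_le[of N] elim z by linarith
    then have "z = 0"
      by linarith
    with z show ?case
      by simp
  qed
  then have "\<forall>\<^sub>F N in sequentially. ?S (Suc N) = 0"
    by (rule eventually_sequentially_Suc[of "\<lambda>N. ?S N = 0", THEN iffD2])
  with S0 have "\<forall>\<^sub>F N in sequentially. c (Suc N) = 0"
    by eventually_elim (use lac_pos in \<open>simp add: less_imp_neq[symmetric]\<close>)
  then show ?thesis
    by (rule eventually_sequentially_Suc[of "\<lambda>N. c N = 0", THEN iffD1])
qed


section \<open>Branches of the binary tree\<close>

text \<open>Nodes are numbered as in a binary heap: \<open>i\<close> has the children \<open>2 i\<close> and \<open>2 i + 1\<close>.\<close>

fun node :: "(nat \<Rightarrow> bool) \<Rightarrow> nat \<Rightarrow> nat" where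
  "node \<epsilon> 0 = 1"
| "node \<epsilon> (Suc n) = 2 * node \<epsilon> n + of_bool (\<epsilon> n)"

lemma node_bounds: "2 ^ n \<le> node \<epsilon> n" "node \<epsilon> n < 2 ^ Suc n"
  by (induction n) auto

lemma node_cong: "(\<And>i. i < n \<Longrightarrow> \<epsilon> i = \<epsilon>' i) \<Longrightarrow> node \<epsilon> n = node \<epsilon>' n"
  by (induction n) auto

text \<open>The parity of a heap number is the last digit and its half is the parent, so a node
  determines the path that leads to it.\<close>

lemma node_eqD: "node \<epsilon> n = node \<epsilon>' n \<Longrightarrow> i < n \<Longrightarrow> \<epsilon> i = \<epsilon>' i"
proof (induction n)
  case (Suc n)
  have "node \<epsilon> n = node \<epsilon>' n \<and> \<epsilon> n = \<epsilon>' n"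
    using Suc.prems(1) by (auto simp: of_bool_def split: if_splits) presburger+
  with Suc show ?case
    by (auto simp: less_Suc_eq)
qed simp

text \<open>The numbers of level \<open>n\<close> lie between \<open>2 ^ n\<close> and
  \<open>2 ^ Suc n\<close>, and these ranges are disjoint for distinct levels.\<close>

lemma node_eq_imp_level_eq:
  assumes "node \<epsilon> n = node \<epsilon>' n'"
  shows "n = n'"
proof -
  have "(2::nat) ^ n < 2 ^ Suc n'" "(2::nat) ^ n' < 2 ^ Suc n"
    using node_bounds(1)[of n \<epsilon>] node_bounds(2)[of \<epsilon> n] node_bounds(1)[of n' \<epsilon>']
      node_bounds(2)[of \<epsilon>' n'] assms by linarith+
  moreover have "(1::nat) < 2"
    by simp
  ultimately have "n < Suc n'" "n' < Suc n"
    using power_less_imp_less_exp by blast+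
  then show ?thesis
    by linarith
qed

text \<open>The series runs over all labels with 0-1 coefficients, so that a finite linear
  combination of branch sums is again one series along \<open>lac\<close>.\<close>

definition branch_sum :: "(nat \<Rightarrow> bool) \<Rightarrow> real" where
  "branch_sum \<epsilon> = (\<Sum>m. of_bool (m \<in> range (node \<epsilon>)) * lac m)"

lemma summable_branch_sum: "summable (\<lambda>m. of_bool (m \<in> range (node \<epsilon>)) * lac m)"
  by (rule summable_lac[of _ 1]) auto

lemma branch_sum_close:
  assumes "\<And>i. i < n \<Longrightarrow> \<epsilon> i = \<epsilon>' i"
  shows "\<bar>branch_sum \<epsilon> - branch_sum \<epsilon>'\<bar> \<le> 2 * lac (2 ^ n)"
proof -
  \<comment> \<open>A label below \<open>2 ^ n\<close> sits at a level below \<open>n\<close>, where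
    the two branches still coincide. The coefficients of the difference thus vanish below
    \<open>2 ^ n\<close>.\<close>
  have *: "m \<in> range (node \<epsilon>')"
    if m: "m \<in> range (node \<epsilon>)" "m < 2 ^ n" and eq: "\<And>i. i < n \<Longrightarrow> \<epsilon> i = \<epsilon>' i" for m \<epsilon> \<epsilon>'
  proof -
    obtain k where k: "m = node \<epsilon> k"
      using m(1) by blast
    then have "(2::nat) ^ k < 2 ^ n"
      using node_bounds(1)[of k \<epsilon>] m(2) by linarith
    then have "k < n"
      by simp
    then have "node \<epsilon> k = node \<epsilon>' k"
      using eq \<open>k < n\<close> by (intro node_cong) auto
    with k show ?thesis
      by simp
  qed
  let ?c = "\<lambda>m. of_bool (m \<in> range (node \<epsilon>)) - of_bool (m \<in> range (node \<epsilon>')) :: real"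
  have "branch_sum \<epsilon> - branch_sum \<epsilon>' = (\<Sum>m. ?c m * lac m)"
    unfolding branch_sum_def suminf_diff[OF summable_branch_sum summable_branch_sum]
    by (simp add: algebra_simps)
  moreover have "\<bar>\<Sum>m. ?c m * lac m\<bar> \<le> 2 * 1 * lac (2 ^ n)"
  proof (rule lac_tail_le)
    show "?c m = 0" if "m < 2 ^ n" for m
      using *[of m \<epsilon> \<epsilon>'] *[of m \<epsilon>' \<epsilon>] that assms by (auto simp: of_bool_def)
  qed auto
  ultimately show ?thesis
    by simp
qed

text \<open>The coefficient \<open>c m\<close> adds up \<open>q\<close> over the branches of
  \<open>E\<close> through the node \<open>m\<close>, and it vanishes for all large
  \<open>m\<close>. Far enough along \<open>\<delta>\<close> no other branch of \<open>E\<close>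
  passes, so the coefficient there is \<open>q \<delta>\<close>.\<close>

lemma branch_sum_int_independent:
  fixes q :: "(nat \<Rightarrow> bool) \<Rightarrow> int"
  assumes fin: "finite E" and sum0: "(\<Sum>\<epsilon>\<in>E. of_int (q \<epsilon>) * branch_sum \<epsilon>) = 0" and "\<delta> \<in> E"
  shows "q \<delta> = 0"
proof -
  define c where "c m = (\<Sum>\<epsilon>\<in>E. q \<epsilon> * of_bool (m \<in> range (node \<epsilon>)))" for m
  have "(\<Sum>m. of_int (c m) * lac m) =
      (\<Sum>m. \<Sum>\<epsilon>\<in>E. of_int (q \<epsilon>) * (of_bool (m \<in> range (node \<epsilon>)) * lac m))"
    unfolding c_def of_int_sum sum_distrib_right by (simp add: mult.assoc)
  also have "\<dots> = (\<Sum>\<epsilon>\<in>E. \<Sum>m. of_int (q \<epsilon>) * (of_bool (m \<in> range (node \<epsilon>)) * lac m))"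
    by (intro suminf_sum summable_mult summable_branch_sum)
  also have "\<dots> = 0"
    using sum0 by (simp add: branch_sum_def suminf_mult[OF summable_branch_sum])
  finally have "\<forall>\<^sub>F m in sequentially. c m = 0"
  proof (rule lac_series_eq_0_imp_eventually_0[rotated])
    show "\<bar>c m\<bar> \<le> (\<Sum>\<epsilon>\<in>E. \<bar>q \<epsilon>\<bar>)" for m
      unfolding c_def by (rule order_trans[OF sum_abs]) (auto intro!: sum_mono simp: abs_mult)
  qed
  then obtain N where N: "\<And>m. m \<ge> N \<Longrightarrow> c m = 0"
    by (auto simp: eventually_sequentially)
  have "\<forall>\<^sub>F n in sequentially. \<forall>\<epsilon>\<in>E - {\<delta>}. node \<delta> n \<notin> range (node \<epsilon>)"
  proof (intro eventually_ball_finite ballI)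
    fix \<epsilon> assume "\<epsilon> \<in> E - {\<delta>}"
    \<comment> \<open>Branches that differ in digit \<open>i\<close> share no node at any level
      above \<open>i\<close>.\<close>
    then obtain i where i: "\<epsilon> i \<noteq> \<delta> i"
      by blast
    show "\<forall>\<^sub>F n in sequentially. node \<delta> n \<notin> range (node \<epsilon>)"
      using eventually_gt_at_top[of i]
    proof eventually_elim
      case (elim n)
      then show ?case
        using node_eq_imp_level_eq node_eqD i by (metis imageE)
    qed
  qed (use fin in simp)
  then obtain n where n: "n \<ge> N" "\<forall>\<epsilon>\<in>E - {\<delta>}. node \<delta> n \<notin> range (node \<epsilon>)"
    unfolding eventually_sequentially by (metis linear)
  have "n < 2 ^ n"
    by (rule less_exp)
  then have "0 = c (node \<delta> n)"
    using N[of "node \<delta> n"] node_bounds(1)[of n \<delta>] n(1) by linarith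
  also have "\<dots> = q \<delta> * of_bool (node \<delta> n \<in> range (node \<delta>)) +
      (\<Sum>\<epsilon>\<in>E - {\<delta>}. q \<epsilon> * of_bool (node \<delta> n \<in> range (node \<epsilon>)))"
    unfolding c_def using fin \<open>\<delta> \<in> E\<close> by (rule sum.remove)
  also have "(\<Sum>\<epsilon>\<in>E - {\<delta>}. q \<epsilon> * of_bool (node \<delta> n \<in> range (node \<epsilon>))) = 0"
    using n(2) by (intro sum.neutral) auto
  finally show ?thesis
    by simp
qed

lemma inj_branch_sum: "inj branch_sum"
proof (rule injI, rule ccontr)
  fix \<epsilon> \<epsilon>' assume *: "branch_sum \<epsilon> = branch_sum \<epsilon>'" "\<epsilon> \<noteq> \<epsilon>'"
  then have "(\<Sum>\<eta>\<in>{\<epsilon>, \<epsilon>'}. of_int (if \<eta> = \<epsilon> then 1 else -1) * branch_sum \<eta>) = 0"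
    by simp
  from branch_sum_int_independent[OF _ this, of \<epsilon>] show False
    by simp
qed


section \<open>Rational independence\<close>

lemma common_denominator:
  fixes q :: "'a \<Rightarrow> rat"
  assumes "finite Y"
  shows "\<exists>D::int. D > 0 \<and> (\<forall>y\<in>Y. of_int D * q y \<in> \<int>)"
  using assms
proof induction
  case empty
  show ?case
    by (rule exI[of _ 1]) simp
next
  case (insert x Y)
  then obtain D :: int where D: "D > 0" "\<forall>y\<in>Y. of_int D * q y \<in> \<int>"
    by blast
  obtain a b where ab: "quotient_of (q x) = (a, b)"
    by fastforce
  then have b: "b > 0" "of_int b * q x = of_int a"
    using quotient_of_denom_pos quotient_of_div by fastforce+
  have "of_int (D * b) * q y \<in> \<int>" if "y \<in> insert x Y" for y
  proof (cases "y = x")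
    case True
    have "of_int (D * b) * q x = of_int D * (of_int b * q x)"
      by simp
    also have "\<dots> = of_int (D * a)"
      by (simp only: b of_int_mult)
    finally show ?thesis
      using True by (simp only: Ints_of_int)
  next
    case False
    have "of_int (D * b) * q y = of_int b * (of_int D * q y)"
      by simp
    moreover have "of_int D * q y \<in> \<int>"
      using D(2) that False by blast
    ultimately show ?thesis
      using Ints_mult[OF Ints_of_int] by metis
  qed
  then show ?case
    using D(1) b(1) by (intro exI[of _ "D * b"]) simp
qed

lemma rat_independent_mono: "rat_independent K \<Longrightarrow> L \<subseteq> K \<Longrightarrow> rat_independent L"
  unfolding rat_independent_iff by (meson order_trans)

text \<open>A common denominator makes the coefficients integers, and injectivity of
  \<open>branch_sum\<close> turns the finite set of reals into a finite set of branches.\<close>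

lemma rat_independent_branch_sums: "rat_independent (range branch_sum)"
  unfolding rat_independent_iff
proof (intro allI impI notI, elim conjE)
  fix Y and q :: "real \<Rightarrow> rat"
  assume Y: "finite Y" "Y \<noteq> {}" "Y \<subseteq> range branch_sum" "\<forall>y\<in>Y. q y \<noteq> 0"
    and sum0: "(\<Sum>y\<in>Y. of_rat (q y) * y) = 0"
  obtain D :: int where D: "D > 0" "\<forall>y\<in>Y. of_int D * q y \<in> \<int>"
    using common_denominator[OF Y(1)] by blast
  \<comment> \<open>On \<open>Y\<close> the argument is already an integer; the floor only gives its
    value the type \<open>int\<close>.\<close>
  define z where "z y = \<lfloor>of_int D * q y\<rfloor>" for y
  have z: "of_int (z y) = (of_int D * of_rat (q y) :: real)" if "y \<in> Y" for y :: real
  proof -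
    have "of_int (z y) = of_int D * q y"
      using D(2) that by (auto simp: z_def elim!: Ints_cases)
    then have "of_rat (of_int (z y)) = (of_rat (of_int D * q y) :: real)"
      by simp
    then show ?thesis
      by (simp add: of_rat_mult)
  qed
  define E where "E = branch_sum -` Y"
  have E: "finite E" "branch_sum ` E = Y"
    using Y(1,3) by (auto simp: E_def intro: finite_vimageI[OF _ inj_branch_sum])
  have "(\<Sum>\<epsilon>\<in>E. of_int (z (branch_sum \<epsilon>)) * branch_sum \<epsilon>) = (\<Sum>y\<in>Y. of_int (z y) * y)"
    unfolding E(2)[symmetric] by (simp add: sum.reindex inj_on_subset[OF inj_branch_sum])
  also have "\<dots> = of_int D * (\<Sum>y\<in>Y. of_rat (q y) * y)"
    unfolding sum_distrib_left by (intro sum.cong) (auto simp: z)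
  finally have rel: "(\<Sum>\<epsilon>\<in>E. of_int (z (branch_sum \<epsilon>)) * branch_sum \<epsilon>) = 0"
    by (simp add: sum0)
  obtain \<epsilon> where "\<epsilon> \<in> E"
    using Y(2) E(2) by blast
  then have "z (branch_sum \<epsilon>) = 0"
    using branch_sum_int_independent[OF E(1) rel] by blast
  moreover have "branch_sum \<epsilon> \<in> Y"
    using \<open>\<epsilon> \<in> E\<close> by (simp add: E_def)
  ultimately show False
    using z[of "branch_sum \<epsilon>"] Y(4) D(1) by auto
qed

text \<open>The four corners of a rectangle with sides in the first two sets, translated by one
  \<open>t\<close>, have alternating sum zero. Independence speaks of distinct elements, so the work
  lies in choosing the corners pairwise distinct.\<close>

lemma rat_independent_no_triple_sumset:
  fixes S\<^sub>1 S\<^sub>2 S\<^sub>3 :: "real set"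
  assumes ind: "rat_independent K" and inf: "infinite S\<^sub>1" "infinite S\<^sub>2" "S\<^sub>3 \<noteq> {}"
  shows "\<not> S\<^sub>1 + S\<^sub>2 + S\<^sub>3 \<subseteq> K"
proof
  assume sub: "S\<^sub>1 + S\<^sub>2 + S\<^sub>3 \<subseteq> K"
  obtain x where x: "x \<in> S\<^sub>1"
    using inf(1) by fastforce
  obtain x' where x': "x' \<in> S\<^sub>1" "x' \<noteq> x"
    using infinite_arbitrarily_large[OF inf(1), of 2] x
    by (metis finite.simps inf(1) singleton_iff subsetI finite_subset)
  obtain y where y: "y \<in> S\<^sub>2"
    using inf(2) by fastforce
  \<comment> \<open>The first excluded value makes corners with the same first coordinate coincide,
    the second gives \<open>x + y' = x' + y\<close>, the third
    \<open>x' + y' = x + y\<close>.\<close>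
  have "infinite (S\<^sub>2 - {y, y + (x' - x), y - (x' - x)})"
    using inf(2) by simp
  then obtain y' where "y' \<in> S\<^sub>2 - {y, y + (x' - x), y - (x' - x)}"
    by (metis all_not_in_conv finite.emptyI)
  then have y': "y' \<in> S\<^sub>2" "y' \<noteq> y" "y' \<noteq> y + (x' - x)" "y' \<noteq> y - (x' - x)"
    by auto
  obtain t where t: "t \<in> S\<^sub>3"
    using inf(3) by blast
  define q :: "real \<Rightarrow> rat" where
    "q v = (if v = x + y + t \<or> v = x' + y' + t then 1 else -1)" for v
  let ?Y = "{x + y + t, x' + y' + t, x' + y + t, x + y' + t}"
  have "?Y \<subseteq> K"
    using x x'(1) y y'(1) t sub by blast
  moreover have "(\<Sum>v\<in>?Y. of_rat (q v) * v) = 0"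
    using x'(2) y'(2-4) by (simp add: q_def)
  moreover have "\<forall>v\<in>?Y. q v \<noteq> 0"
    by (simp add: q_def)
  ultimately show False
    using ind[unfolded rat_independent_iff, rule_format, of ?Y q] by blast
qed

text \<open>A nondegenerate interval contains two nonzero rationals.\<close>

lemma rat_independent_connected_subset:
  assumes ind: "rat_independent K" and C: "C \<subseteq> K" "connected C" "x \<in> C" "y \<in> C"
  shows "x = y"
proof (rule ccontr)
  assume "x \<noteq> y"
  define a b where "a = min x y" and "b = max x y"
  have "a < b" "a \<in> C" "b \<in> C"
    using \<open>x \<noteq> y\<close> C by (auto simp: a_def b_def min_def max_def)
  then have sub: "{a..b} \<subseteq> K"
    using connected_contains_Icc[OF C(2)] C(1) by blast
  obtain p where p: "a < of_rat p" "of_rat p < b"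
    using of_rat_dense[OF \<open>a < b\<close>] by blast
  obtain r where r: "a < of_rat r" "of_rat r < (of_rat p :: real)"
    using of_rat_dense[OF p(1)] by blast
  \<comment> \<open>\<open>0\<close> alone satisfies a nontrivial relation. Its absence makes
    \<open>p\<close> and \<open>r\<close> admissible as nonzero coefficients.\<close>
  have "0 \<notin> K"
    using ind[unfolded rat_independent_iff, rule_format, of "{0}" "\<lambda>_. 1"] by auto
  moreover have pr: "of_rat p \<in> K" "of_rat r \<in> K"
    using p r sub by auto
  ultimately have "p \<noteq> 0" "r \<noteq> 0"
    by (metis of_rat_0)+
  have "r \<noteq> p"
    using r by auto
  \<comment> \<open>The relation is \<open>r * p - p * r = 0\<close>.\<close>
  define q where "q v = (if v = of_rat p then r else - p)" for v :: real
  have "(\<Sum>v\<in>{of_rat p, of_rat r}. of_rat (q v) * v) = 0"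
    using \<open>r \<noteq> p\<close> by (simp add: q_def of_rat_minus)
  moreover have "{of_rat p, of_rat r} \<subseteq> K"
    using pr by simp
  moreover have "\<forall>v\<in>{of_rat p, of_rat r}. q v \<noteq> 0"
    using \<open>p \<noteq> 0\<close> \<open>r \<noteq> 0\<close> by (simp add: q_def)
  ultimately show False
    using ind[unfolded rat_independent_iff, rule_format, of "{of_rat p, of_rat r}" q] by blast
qed


section \<open>Logarithmic Hausdorff dimension\<close>

text \<open>The bound on \<open>R\<close> matters: from \<open>exp (-1)\<close> on the gauge takes
  the dummy value \<open>0\<close>.\<close>

lemma log_gauge_mono:
  assumes "s > 0" "0 \<le> r" "r \<le> R" "R < exp (-1)"
  shows "log_gauge s r \<le> log_gauge s R"
proof (cases "r = 0")
  case False
  have "R < 1"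
    using assms(4) by (rule less_trans) simp
  with False assms have "0 < ln (1 / R)" "ln (1 / R) \<le> ln (1 / r)"
    by (simp_all add: field_simps)
  then show ?thesis
    using False assms by (simp add: log_gauge_def powr_mono2')
qed (simp add: log_gauge_def)

lemma log_gauge_nonneg: "0 \<le> log_gauge s r"
  by (simp add: log_gauge_def)

lemma log_hausdorff_dim_mono: "L \<subseteq> K \<Longrightarrow> log_hausdorff_dim L \<le> log_hausdorff_dim K"
proof -
  assume sub: "L \<subseteq> K"
  have pre: "log_premeasure s L \<delta> \<le> log_premeasure s K \<delta>" for s \<delta>
    unfolding log_premeasure_def using sub by (intro INF_superset_mono) auto
  have "log_hausdorff_measure s L \<le> log_hausdorff_measure s K" for s
    unfolding log_hausdorff_measure_eq_SUP by (intro SUP_mono' pre)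
  then have "log_hausdorff_measure s L = 0" if "log_hausdorff_measure s K = 0" for s
    using that by (metis le_zero_eq)
  then show ?thesis
    unfolding log_hausdorff_dim_def by (intro Inf_superset_mono image_mono) auto
qed

lemma log_hausdorff_dim_nonneg: "0 \<le> log_hausdorff_dim K"
  unfolding log_hausdorff_dim_def by (intro Inf_greatest) auto

text \<open>The cylinders of level \<open>n\<close> form the cover. Points in one cylinder come from
  branches with the same first \<open>n\<close> digits, which bounds its diameter.\<close>

lemma log_premeasure_branch_sums_le:
  assumes s: "s > 0" and small: "2 * lac (2 ^ n) < \<delta>" "2 * lac (2 ^ n) < exp (-1)"
  shows "log_premeasure s (range branch_sum) \<delta> \<le> ennreal (2 * 2 ^ n * log_gauge s (2 * lac (2 ^ n)))"
proof -
  define U where "U i = branch_sum ` {\<epsilon>. node \<epsilon> n = i}" for i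
  have close: "norm (u - v) \<le> 2 * lac (2 ^ n)" if "u \<in> U i" "v \<in> U i" for u v i
    using that node_eqD by (auto simp: U_def intro!: branch_sum_close)
  have diam: "diameter (U i) \<le> 2 * lac (2 ^ n)" for i
    using close lac_pos[of "2 ^ n"] by (intro diameter_le) auto
  have bdd: "bounded (U i)" for i
  proof (cases "U i = {}")
    case False
    then obtain u where "u \<in> U i"
      by blast
    then show ?thesis
      using close unfolding bounded_def dist_norm by blast
  qed simp
  have "log_premeasure s (range branch_sum) \<delta> \<le> (\<Sum>i. ennreal (log_gauge s (diameter (U i))))"
    unfolding log_premeasure_def
    by (rule INF_lower) (use bdd le_less_trans[OF diam small(1)] in \<open>auto simp: U_def\<close>)
  \<comment> \<open>Indexing by heap numbers also counts the empty sets below level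
    \<open>n\<close>, hence \<open>2 * 2 ^ n\<close> terms instead of \<open>2 ^ n\<close>. Empty
    sets have diameter \<open>0\<close> and gauge \<open>0\<close>.\<close>
  also have "\<dots> = (\<Sum>i<(2::nat) ^ Suc n. ennreal (log_gauge s (diameter (U i))))"
  proof (rule suminf_finite)
    fix i :: nat assume "i \<notin> {..<2 ^ Suc n}"
    then have "U i = {}"
      using node_bounds(2)[of _ n] by (auto simp: U_def)
    then show "ennreal (log_gauge s (diameter (U i))) = 0"
      by (simp add: log_gauge_def)
  qed simp
  also have "\<dots> \<le> (\<Sum>i<(2::nat) ^ Suc n. ennreal (log_gauge s (2 * lac (2 ^ n))))"
    using s small(2) diam bdd
    by (intro sum_mono ennreal_leI log_gauge_mono) (auto intro: diameter_ge_0)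
  also have "\<dots> = ennreal (2 * 2 ^ n * log_gauge s (2 * lac (2 ^ n)))"
    by (subst sum_ennreal) (simp_all add: log_gauge_nonneg)
  finally show ?thesis .
qed

text \<open>For \<open>k = 2 ^ n\<close> this is, up to a factor \<open>2\<close>, the cost of the
  cylinder cover. The power decays like \<open>(2 powr - s) ^ k\<close>, which beats the linear
  factor for every positive \<open>s\<close>.\<close>

lemma mult_power2_powr_tendsto_0:
  assumes "s > 0"
  shows "(\<lambda>k. real k * (((2::real) ^ k - 1) * ln 2) powr - s) \<longlonglongrightarrow> 0"
proof (rule tendsto_sandwich[of "\<lambda>_. 0"])
  have "(\<lambda>k. real k * (2 powr - s) ^ k) \<longlonglongrightarrow> 0"
    by (rule powser_times_n_limit_0) (use assms in \<open>simp add: powr_less_one\<close>)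
  then show "(\<lambda>k. 4 powr s * (real k * (2 powr - s) ^ k)) \<longlonglongrightarrow> 0"
    by (rule tendsto_mult_right_zero)
  show "\<forall>\<^sub>F k in sequentially.
      real k * (((2::real) ^ k - 1) * ln 2) powr - s \<le> 4 powr s * (real k * (2 powr - s) ^ k)"
    using eventually_ge_at_top[of 1]
  proof eventually_elim
    case (elim k)
    have "(2::real) ^ 1 \<le> 2 ^ k"
      using elim by (intro power_increasing) auto
    \<comment> \<open>Two losses of a factor \<open>2\<close>, from
      \<open>2 ^ k - 1 \<ge> 2 ^ k / 2\<close> and from \<open>ln 2 \<ge> 1 / 2\<close>, make up the
      constant \<open>4\<close>.\<close>
    then have "((2::real) ^ k / 2) * (1 / 2) \<le> (2 ^ k - 1) * ln 2"
      using ln2_ge_two_thirds by (intro mult_mono) auto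
    then have "((2 ^ k - 1) * ln 2) powr - s \<le> ((2::real) ^ k / 4) powr - s"
      using assms by (intro powr_mono2') auto
    also have "\<dots> = ((2::real) ^ k) powr - s * 4 powr s"
      by (simp add: powr_divide powr_minus field_simps)
    also have "((2::real) ^ k) powr - s = (2 powr - s) ^ k"
      by (simp add: powr_powr powr_power mult.commute flip: powr_realpow)
    finally have "((2 ^ k - 1) * ln 2) powr - s \<le> 4 powr s * (2 powr - s) ^ k"
      by (simp only: mult.commute)
    then show ?case
      unfolding mult.left_commute[of "4 powr s"] by (rule mult_left_mono) simp
  qed
qed simp_all

lemma log_premeasure_branch_sums:
  assumes s: "s > 0" and "\<delta> > 0"
  shows "log_premeasure s (range branch_sum) \<delta> = 0"
proof -
  let ?r = "\<lambda>n. 2 * lac (2 ^ n)"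
  have lim: "?r \<longlonglongrightarrow> 0"
    using LIMSEQ_subseq_LIMSEQ[OF lac_tendsto_0, of "\<lambda>n. 2 ^ n"]
    by (intro tendsto_mult_right_zero) (simp add: strict_mono_def o_def)
  have ev: "\<forall>\<^sub>F n in sequentially. ?r n < \<delta> \<and> ?r n < exp (-1)"
    using order_tendstoD(2)[OF lim] \<open>\<delta> > 0\<close> by (intro eventually_conj) auto
  have lim': "(\<lambda>n. 2 * 2 ^ n * (((2::real) ^ 2 ^ n - 1) * ln 2) powr - s) \<longlonglongrightarrow> 0"
    using LIMSEQ_subseq_LIMSEQ[OF mult_power2_powr_tendsto_0[OF s], of "\<lambda>n. 2 ^ n"]
    unfolding mult.assoc by (intro tendsto_mult_right_zero) (simp add: strict_mono_def o_def)
  have eq: "\<forall>\<^sub>F n in sequentially.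
      2 * 2 ^ n * log_gauge s (?r n) = 2 * 2 ^ n * (((2::real) ^ 2 ^ n - 1) * ln 2) powr - s"
    using ev
  proof eventually_elim
    case (elim n)
    \<comment> \<open>The \<open>- 1\<close> is the price of the factor \<open>2\<close> in the
      diameter bound.\<close>
    have "ln (1 / ?r n) = (2 ^ 2 ^ n - 1) * ln 2"
      by (simp add: lac_def ln_div ln_mult ln_realpow power_one_over algebra_simps)
    then show ?case
      using elim lac_pos[of "2 ^ n"] by (simp add: log_gauge_def)
  qed
  have "(\<lambda>n. 2 * 2 ^ n * log_gauge s (?r n)) \<longlonglongrightarrow> 0"
    using tendsto_cong[OF eq] lim' by blast
  then have "(\<lambda>n. ennreal (2 * 2 ^ n * log_gauge s (?r n))) \<longlonglongrightarrow> ennreal 0"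
    by (intro tendsto_ennrealI)
  then have "log_premeasure s (range branch_sum) \<delta> \<le> ennreal 0"
    by (rule tendsto_lowerbound)
      (use ev in \<open>auto elim!: eventually_mono intro!: log_premeasure_branch_sums_le s\<close>)
  then show ?thesis
    by simp
qed

lemma log_hausdorff_dim_branch_sums: "log_hausdorff_dim (range branch_sum) = 0"
proof (rule antisym[OF _ log_hausdorff_dim_nonneg])
  have "log_hausdorff_dim (range branch_sum) \<le> ereal s" if "s > 0" for s
    unfolding log_hausdorff_dim_def
  proof (intro Inf_lower imageI CollectI conjI that)
    show "log_hausdorff_measure s (range branch_sum) = 0"
      unfolding log_hausdorff_measure_eq_SUP using that
      by (simp add: log_premeasure_branch_sums)
  qed
  then show "log_hausdorff_dim (range branch_sum) \<le> 0"
    using ereal_le_epsilon2[of "log_hausdorff_dim (range branch_sum)" 0] by simp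
qed


section \<open>The family of Cantor sets\<close>

text \<open>\<open>\<delta>\<close> selects the member of the family, while
  \<open>\<epsilon>\<close> is the coordinate running through that Cantor set.\<close>

definition interleave :: "(nat \<Rightarrow> bool) \<Rightarrow> (nat \<Rightarrow> bool) \<Rightarrow> nat \<Rightarrow> bool" where
  "interleave \<delta> \<epsilon> i = (if even i then \<delta> (i div 2) else \<epsilon> (i div 2))"

lemma interleave_eqD:
  assumes "interleave \<delta> \<epsilon> = interleave \<delta>' \<epsilon>'"
  shows "\<delta> = \<delta>'" "\<epsilon> = \<epsilon>'"
proof -
  have "\<delta> i = \<delta>' i \<and> \<epsilon> i = \<epsilon>' i" for i
    using fun_cong[OF assms, of "2 * i"] fun_cong[OF assms, of "Suc (2 * i)"]
    by (simp add: interleave_def)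
  then show "\<delta> = \<delta>'" "\<epsilon> = \<epsilon>'"
    by auto
qed

definition branch_cantor :: "(nat \<Rightarrow> bool) \<Rightarrow> real set" where
  "branch_cantor \<delta> = range (\<lambda>\<epsilon>. branch_sum (interleave \<delta> \<epsilon>))"

lemma branch_sum_interleave_close:
  assumes "\<And>i. i < n \<Longrightarrow> \<epsilon> i = \<epsilon>' i"
  shows "\<bar>branch_sum (interleave \<delta> \<epsilon>) - branch_sum (interleave \<delta> \<epsilon>')\<bar> \<le> 2 * lac (2 ^ n)"
  using assms by (intro branch_sum_close) (auto simp: interleave_def)

lemma lac_small:
  assumes "e > 0"
  obtains n where "2 * lac (2 ^ n) < e"
proof -
  have "(\<lambda>n. 2 * lac (2 ^ n)) \<longlonglongrightarrow> 0"
    using LIMSEQ_subseq_LIMSEQ[OF lac_tendsto_0, of "\<lambda>n. 2 ^ n"]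
    by (intro tendsto_mult_right_zero) (simp add: strict_mono_def o_def)
  from order_tendstoD(2)[OF this assms] show ?thesis
    using that by (auto simp: eventually_sequentially)
qed

lemma continuous_branch_sum_interleave:
  "continuous_on UNIV (\<lambda>\<epsilon>. branch_sum (interleave \<delta> \<epsilon>))"
  unfolding continuous_on_def
proof (intro ballI tendstoI)
  fix \<epsilon> :: "nat \<Rightarrow> bool" and e :: real assume "e > 0"
  then obtain n where n: "2 * lac (2 ^ n) < e"
    by (rule lac_small)
  \<comment> \<open>The cylinder of the first \<open>n\<close> digits of \<open>\<epsilon>\<close>:
    a finite intersection of open coordinate conditions.\<close>
  define A where "A = (\<Inter>i<n. (\<lambda>\<eta>. \<eta> i) -` {\<epsilon> i})"
  have "open A"
    unfolding A_def
    by (intro open_INT ballI open_vimage continuous_on_product_coordinates open_discrete) auto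
  moreover have "\<epsilon> \<in> A"
    by (simp add: A_def)
  moreover have "dist (branch_sum (interleave \<delta> \<eta>)) (branch_sum (interleave \<delta> \<epsilon>)) < e" if "\<eta> \<in> A" for \<eta>
    using branch_sum_interleave_close[of n \<eta> \<epsilon> \<delta>] that n by (auto simp: A_def dist_real_def)
  ultimately show "\<forall>\<^sub>F \<eta> in at \<epsilon> within UNIV.
      dist (branch_sum (interleave \<delta> \<eta>)) (branch_sum (interleave \<delta> \<epsilon>)) < e"
    unfolding eventually_at_topological by blast
qed

text \<open>Tychonoff's theorem for the abstract product topology, carried over to the topology of
  the function type.\<close>

lemma compact_UNIV_bool_sequences: "compact (UNIV :: (nat \<Rightarrow> bool) set)"
proof -
  have "compact_space (product_topology (\<lambda>_::nat. euclidean :: bool topology) UNIV)"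
    unfolding compact_space_product_topology by (simp add: compact_space_def finite_imp_compact)
  then show ?thesis
    unfolding euclidean_product_topology by (simp add: compact_space_def)
qed

lemma islimpt_branch_cantor:
  assumes "x \<in> branch_cantor \<delta>"
  shows "x islimpt branch_cantor \<delta>"
  unfolding islimpt_approachable
proof (intro allI impI)
  fix e :: real assume "e > 0"
  then obtain n where n: "2 * lac (2 ^ n) < e"
    by (rule lac_small)
  obtain \<epsilon> where x: "x = branch_sum (interleave \<delta> \<epsilon>)"
    using assms by (auto simp: branch_cantor_def)
  \<comment> \<open>Flipping a single late digit moves the point a little, and by injectivity it
    does move.\<close>
  let ?\<eta> = "\<epsilon>(n := \<not> \<epsilon> n)"
  have "?\<eta> \<noteq> \<epsilon>"
    by (metis fun_upd_same)
  then have "branch_sum (interleave \<delta> ?\<eta>) \<noteq> x"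
    using inj_branch_sum interleave_eqD(2) unfolding x by (metis injD)
  moreover have "dist (branch_sum (interleave \<delta> ?\<eta>)) x < e"
    using branch_sum_interleave_close[of n ?\<eta> \<epsilon> \<delta>] n by (simp add: x dist_real_def)
  ultimately show "\<exists>x'\<in>branch_cantor \<delta>. x' \<noteq> x \<and> dist x' x < e"
    by (auto simp: branch_cantor_def)
qed

lemma branch_cantor_subset: "branch_cantor \<delta> \<subseteq> range branch_sum"
  by (auto simp: branch_cantor_def)

lemma rat_independent_branch_cantor: "rat_independent (branch_cantor \<delta>)"
  using rat_independent_mono[OF rat_independent_branch_sums branch_cantor_subset] .

text \<open>Compactness comes from the continuous parametrization by digit sequences, total
  disconnectedness from rational independence.\<close>

lemma cantor_set_branch_cantor: "cantor_set (branch_cantor \<delta>)"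
  unfolding cantor_set_def
proof (intro conjI ballI allI impI)
  show "compact (branch_cantor \<delta>)"
    unfolding branch_cantor_def
    by (intro compact_continuous_image continuous_branch_sum_interleave compact_UNIV_bool_sequences)
  show "x = y" if "C \<subseteq> branch_cantor \<delta>" "connected C" "x \<in> C" "y \<in> C" for C x y
    using rat_independent_connected_subset[OF rat_independent_branch_cantor that] .
qed (auto simp: branch_cantor_def[of \<delta>] intro: islimpt_branch_cantor[unfolded branch_cantor_def])

lemma log_hausdorff_dim_branch_cantor: "log_hausdorff_dim (branch_cantor \<delta>) = 0"
  using log_hausdorff_dim_mono[OF branch_cantor_subset] log_hausdorff_dim_branch_sums
    log_hausdorff_dim_nonneg by (metis antisym)

text \<open>A single common point suffices: it determines its branch, and the even digits of the
  branch are the parameter.\<close>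

lemma inj_branch_cantor: "inj branch_cantor"
proof (rule injI)
  fix \<delta> \<delta>' assume "branch_cantor \<delta> = branch_cantor \<delta>'"
  \<comment> \<open>The second \<open>\<delta>\<close> is an arbitrary choice of the odd
    digits.\<close>
  then have "branch_sum (interleave \<delta> \<delta>) \<in> branch_cantor \<delta>'"
    by (auto simp: branch_cantor_def)
  then obtain \<epsilon> where "branch_sum (interleave \<delta> \<delta>) = branch_sum (interleave \<delta>' \<epsilon>)"
    by (auto simp: branch_cantor_def)
  then show "\<delta> = \<delta>'"
    by (rule interleave_eqD(1)[OF injD[OF inj_branch_sum]])
qed

lemma uncountable_bool_sequences: "uncountable (UNIV :: (nat \<Rightarrow> bool) set)"
proof
  assume "countable (UNIV :: (nat \<Rightarrow> bool) set)"
  then obtain f :: "nat \<Rightarrow> nat \<Rightarrow> bool" where f: "range f = UNIV"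
    using uncountable_def by blast
  \<comment> \<open>Cantor's diagonal sequence; evaluating at \<open>n\<close> gives the
    contradiction.\<close>
  then obtain n where "f n = (\<lambda>i. \<not> f i i)"
    by (metis UNIV_I imageE)
  then show False
    by (metis (full_types))
qed

theorem corollary3p5:
  shows "\<exists>\<K> :: real set set. uncountable \<K> \<and>
    (\<forall>K\<in>\<K>. cantor_set K \<and>
       rat_independent K \<and>
       log_hausdorff_dim K = 0 \<and>
       \<not> (\<exists>S\<^sub>1 S\<^sub>2 S\<^sub>3 :: real set. infinite S\<^sub>1 \<and> infinite S\<^sub>2 \<and> infinite S\<^sub>3 \<and> S\<^sub>1 + S\<^sub>2 + S\<^sub>3 \<subseteq> K))"
proof (intro exI[of _ "range branch_cantor"] conjI ballI)
  show "uncountable (range branch_cantor)"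
    using uncountable_bool_sequences inj_branch_cantor countable_image_inj_on by blast
next
  fix K assume "K \<in> range branch_cantor"
  then obtain \<delta> where K: "K = branch_cantor \<delta>"
    by blast
  show ind: "rat_independent K" and "cantor_set K" and "log_hausdorff_dim K = 0"
    unfolding K by (rule rat_independent_branch_cantor cantor_set_branch_cantor
        log_hausdorff_dim_branch_cantor)+
  show "\<not> (\<exists>S\<^sub>1 S\<^sub>2 S\<^sub>3 :: real set. infinite S\<^sub>1 \<and> infinite S\<^sub>2 \<and> infinite S\<^sub>3 \<and> S\<^sub>1 + S\<^sub>2 + S\<^sub>3 \<subseteq> K)"
    using rat_independent_no_triple_sumset[OF ind] by (metis infinite_imp_nonempty)
qed

end
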